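(* Let $M_1=(E_1,r_1)$ and $M_2=(E_2,r_2)$ be $q$-matroids, let $\pi_i:E_1\oplus E_2\to E_i$ and $\iota_i:E_i\to E_1\oplus E_2$ be the projections and canonical embeddings, let $\lambda_1(A)=r_1(E_1)-r_1(A)$ for $A\le E_1$ and $\nu_2(B)=\dim(B)-r_2(B)$ for $B\le E_2$. Let $\mathcal{I}$ be the collection of independent spaces of the free product $M_1\square M_2$ and let $r_{\mathcal{I}}(X)=\max\{\dim(X\cap I): I\in\mathcal{I}\}$ for $X\in\mathcal{L}(E_1\oplus E_2)$ be its rank function. Then, for every $X\in\mathcal{L}(E_1\oplus E_2)$, $$r_{\mathcal{I}}(X)=r_1(\pi_1(X\cap\iota_1(E_1)))+r_2(\pi_2(X))+\min\{\lambda_1(\pi_1(X\cap\iota_1(E_1))),\ \nu_2(\pi_2(X))\}.$$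
   Context: Let $\mathbb{F}_q$ be the finite field with $q$ elements. For a finite-dimensional $\mathbb{F}_q$-vector space $E$, $\mathcal{L}(E)$ denotes the lattice of its $\mathbb{F}_q$-subspaces. A $q$-matroid with ground space $E$ is a pair $M=(E,r)$ where $r:\mathcal{L}(E)\to\mathbb{Z}$ satisfies: (R1) $0\le r(A)\le\dim(A)$; (R2) $A\le B\Rightarrow r(A)\le r(B)$; (R3) $r(A+B)+r(A\cap B)\le r(A)+r(B)$. A subspace $A$ is independent if $r(A)=\dim(A)$; the collection of independent spaces determines the $q$-matroid uniquely. The free product $M_1\square M_2$ is the $q$-matroid with ground space $E_1\oplus E_2$ whose collection of independent spaces is $$\mathcal{I}=\{I\leq E_1\oplus E_2:\ \pi_1(I\cap\iota_1(E_1))\text{ is independent in }M_1,\ \lambda_1(\pi_1(I\cap\iota_1(E_1)))\geq\nu_2(\pi_2(I))\}$$ (this family is indeed the collection of independent spaces of a $q$-matroid). *)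

theory Defs
  imports "HOL-Analysis.Product_Vector"
begin

text \<open>
  The ground space \<open>E\<close> of a \<open>q\<close>-matroid is the whole type \<open>'e\<close>, regarded as a
  finite-dimensional vector space over the finite field \<open>'k\<close> with \<open>q = CARD('k)\<close> elements.
  The set \<open>Basis\<close> is only the library's witness of finite-dimensionality.
  The values of \<open>r\<close> on sets that are not subspaces are irrelevant.
\<close>

locale q_matroid = finite_dimensional_vector_space s Basis
  for s :: "'k::{field,finite} \<Rightarrow> 'e::ab_group_add \<Rightarrow> 'e"
    and Basis :: "'e set" +
  fixes r :: "'e set \<Rightarrow> int"
  assumes rank_bounds: "subspace A \<Longrightarrow> 0 \<le> r A \<and> r A \<le> int (dim A)"
    and rank_mono: "subspace A \<Longrightarrow> subspace B \<Longrightarrow> A \<subseteq> B \<Longrightarrow> r A \<le> r B"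
    and rank_submodular: "subspace A \<Longrightarrow> subspace B \<Longrightarrow>
      r {x + y | x y. x \<in> A \<and> y \<in> B} + r (A \<inter> B) \<le> r A + r B"

definition q_indep :: "('k::field \<Rightarrow> 'e::ab_group_add \<Rightarrow> 'e) \<Rightarrow> ('e set \<Rightarrow> int) \<Rightarrow> 'e set \<Rightarrow> bool"
  where "q_indep s r A \<longleftrightarrow>
    module.subspace s A \<and> r A = int (vector_space.dim s A)"

text \<open>The functions \<open>\<lambda>\<close> and \<open>\<nu>\<close> of a \<open>q\<close>-matroid.\<close>

definition rank_lack :: "('e set \<Rightarrow> int) \<Rightarrow> 'e set \<Rightarrow> int"
  where "rank_lack r A = r UNIV - r A"

definition nullity :: "('k::field \<Rightarrow> 'e::ab_group_add \<Rightarrow> 'e) \<Rightarrow> ('e set \<Rightarrow> int) \<Rightarrow> 'e set \<Rightarrow> int"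
  where "nullity s r B = int (vector_space.dim s B) - r B"

text \<open>
  The direct sum \<open>E\<^sub>1 \<oplus> E\<^sub>2\<close> is the product type with scalar multiplication
  \<open>module_prod.scale s1 s2\<close>; the projections are \<open>fst\<close> and \<open>snd\<close>.
\<close>

abbreviation iota1 :: "'a \<Rightarrow> 'a \<times> 'b::zero"
  where "iota1 x \<equiv> (x, 0)"

definition free_product_indep ::
  "('k::field \<Rightarrow> 'a::ab_group_add \<Rightarrow> 'a) \<Rightarrow> ('a set \<Rightarrow> int) \<Rightarrow>
   ('k \<Rightarrow> 'b::ab_group_add \<Rightarrow> 'b) \<Rightarrow> ('b set \<Rightarrow> int) \<Rightarrow> ('a \<times> 'b) set set"
  where "free_product_indep s1 r1 s2 r2 =
    {I. module.subspace (module_prod.scale s1 s2) I \<and>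
        q_indep s1 r1 (fst ` (I \<inter> range iota1)) \<and>
        rank_lack r1 (fst ` (I \<inter> range iota1)) \<ge> nullity s2 r2 (snd ` I)}"

text \<open>
  The rank function of a collection of independent spaces. In a finite-dimensional space the
  maximum ranges over a finite set of numbers, which is nonempty if the collection is.
\<close>

definition rank_of_indep ::
  "('k::field \<Rightarrow> 'e::ab_group_add \<Rightarrow> 'e) \<Rightarrow> 'e set set \<Rightarrow> 'e set \<Rightarrow> int"
  where "rank_of_indep s \<I> X = int (Max {vector_space.dim s (X \<inter> I) | I. I \<in> \<I>})"

end

theory Submission
  imports Defs
begin

text \<open>
  A subspace \<open>I\<close> of the direct sum is determined by its slice \<open>A = \<pi>\<^sub>1(I \<inter> \<iota>\<^sub>1(E\<^sub>1))\<close>, its projection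
  \<open>B = \<pi>\<^sub>2(I)\<close> and a linear section of \<open>\<pi>\<^sub>2\<close> over \<open>B\<close>, and \<open>dim I = dim A + dim B\<close>.
  Passing from \<open>I\<close> to \<open>X \<inter> I\<close> shrinks both parts, so monotonicity of the rank and of the nullity
  gives the upper bound. For equality, take a basis \<open>A\<close> of the slice of \<open>X\<close> and enlarge a basis of
  \<open>\<pi>\<^sub>2(X)\<close> inside \<open>\<pi>\<^sub>2(X)\<close> until its nullity is the required minimum, then lift along a
  section into \<open>X\<close>.
\<close>

lemma (in finite_dimensional_vector_space) dim_span_insert_subspace:
  assumes "subspace A" "x \<notin> A"
  shows "dim (span (insert x A)) = Suc (dim A)"
  using assms by (simp add: dim_insert span_eq_iff[THEN iffD2])

text \<open>Dimensions are bounded by \<open>dimension\<close>, so a maximum is attained;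
  \<open>Suc\<close> turns this into the strict bound that \<open>ex_has_greatest_nat\<close>
  expects.\<close>

lemma (in finite_dimensional_vector_space) obtain_max_dim:
  assumes "P S"
  obtains T where "P T" "\<And>U. P U \<Longrightarrow> dim U \<le> dim T"
  using ex_has_greatest_nat[of P S dim "Suc dimension"] assms dim_subset_UNIV
  by (metis less_Suc_eq_le)

lemma (in finite_dimensional_vector_space) obtain_subspace_between:
  assumes "subspace A" "subspace B" "A \<subseteq> B" "dim A \<le> n" "n \<le> dim B"
  obtains C where "subspace C" "A \<subseteq> C" "C \<subseteq> B" "dim C = n"
proof -
  \<comment> \<open>The upper bound on \<open>n\<close> is a premise inside the induction formula,
    because it has to be weakened from \<open>Suc n\<close> to \<open>n\<close>.\<close>
  have "n \<le> dim B \<longrightarrow> (\<exists>C. subspace C \<and> A \<subseteq> C \<and> C \<subseteq> B \<and> dim C = n)"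
    using \<open>dim A \<le> n\<close>
  proof (induction n rule: dec_induct)
    case base
    then show ?case using assms by blast
  next
    case (step n)
    show ?case
    proof
      assume n: "Suc n \<le> dim B"
      then obtain C where C: "subspace C" "A \<subseteq> C" "C \<subseteq> B" "dim C = n"
        using step.IH by auto
      then obtain x where x: "x \<in> B" "x \<notin> C"
        using n by (metis not_less_eq_eq order_refl subsetI subset_antisym)
      have "insert x C \<subseteq> B" using x C by auto
      then have "span (insert x C) \<subseteq> B" using \<open>subspace B\<close> by (rule span_minimal)
      moreover have "A \<subseteq> span (insert x C)" using C(2) span_superset[of "insert x C"] by blast
      ultimately show "\<exists>C. subspace C \<and> A \<subseteq> C \<and> C \<subseteq> B \<and> dim C = Suc n"
        using dim_span_insert_subspace[OF C(1) x(2)] C(4) subspace_span by metis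
    qed
  qed
  then show ?thesis using assms that by blast
qed

section \<open>Rank, nullity and bases in a single q-matroid\<close>

context q_matroid
begin

lemma nullity_nonneg: "subspace A \<Longrightarrow> 0 \<le> nullity s r A"
  using rank_bounds by (simp add: nullity_def)

lemma rank_lack_nonneg: "subspace A \<Longrightarrow> 0 \<le> rank_lack r A"
  using rank_mono[OF _ subspace_UNIV] by (simp add: rank_lack_def)

lemma q_indep_iff_nullity: "subspace A \<Longrightarrow> q_indep s r A \<longleftrightarrow> nullity s r A = 0"
  by (auto simp: q_indep_def nullity_def)

text \<open>Diminishing returns: apply submodularity to \<open>A\<close> and
  \<open>span (insert x C)\<close>, whose sum is \<open>span (insert x A)\<close> and whose
  intersection contains \<open>C\<close>.\<close>

lemma rank_span_insert_le:
  assumes A: "subspace A" and C: "subspace C" "C \<subseteq> A"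
  shows "r (span (insert x A)) + r C \<le> r A + r (span (insert x C))"
proof -
  let ?D = "span (insert x C)"
  have sums: "{a + y | a y. a \<in> A \<and> y \<in> ?D} = span (insert x A)"
  proof -
    have "span (A \<union> insert x C) = {a + y | a y. a \<in> A \<and> y \<in> ?D}"
      unfolding span_Un using A by (metis span_eq_iff)
    moreover have "A \<union> insert x C = insert x A" using C by auto
    ultimately show ?thesis by simp
  qed
  have "r C \<le> r (A \<inter> ?D)"
    using A C span_superset[of "insert x C"] by (intro rank_mono subspace_inter) auto
  then show ?thesis
    using rank_submodular[OF A, of ?D] unfolding sums by auto
qed

lemma rank_span_insert_le_Suc:
  assumes "subspace A"
  shows "r (span (insert x A)) \<le> r A + 1"
proof -
  have "dim (span {x}) \<le> card {x}" unfolding dim_span by (rule dim_le_card') simp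
  then have "r (span {x}) \<le> 1"
    using rank_bounds[of "span {x}"] by simp
  moreover have "0 \<le> r {0}" using rank_bounds[of "{0}"] by simp
  \<comment> \<open>Diminishing returns with \<open>C = {0}\<close>: the gain over \<open>A\<close>
    is at most the gain over the zero space.\<close>
  ultimately show ?thesis
    using rank_span_insert_le[OF assms, of "{0}" x] subspace_0[OF assms]
    by (auto simp: insert_commute)
qed

text \<open>Climb from \<open>A\<close> to \<open>B\<close> one vector at a time: each step raises
  the dimension by exactly one and the rank by at most one.\<close>

lemma nullity_mono:
  assumes "subspace A" "subspace B" "A \<subseteq> B"
  shows "nullity s r A \<le> nullity s r B"
  using assms
proof (induction "dim B - dim A" arbitrary: A rule: less_induct)
  case less
  show ?case
  proof (cases "A = B")
    case False
    then obtain x where x: "x \<in> B" "x \<notin> A" using less.prems by blast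
    let ?A = "span (insert x A)"
    have AB: "?A \<subseteq> B" using x less.prems by (intro span_minimal) auto
    have d: "dim ?A = Suc (dim A)" using less.prems(1) x(2) by (rule dim_span_insert_subspace)
    have "nullity s r A \<le> nullity s r ?A"
      using rank_span_insert_le_Suc[OF less.prems(1), of x] d by (simp add: nullity_def)
    also have "\<dots> \<le> nullity s r B"
      using d dim_subset[OF AB] AB less.prems by (intro less.hyps) auto
    finally show ?thesis .
  qed simp
qed

lemma q_indep_subset:
  assumes "q_indep s r B" "subspace A" "A \<subseteq> B"
  shows "q_indep s r A"
  using assms nullity_mono[of A B] nullity_nonneg[of A]
  by (metis q_indep_def q_indep_iff_nullity order_antisym)

text \<open>A largest independent \<open>I\<close> inside \<open>A\<close> works: no single vector
  of \<open>A\<close> raises its rank, and by diminishing returns neither do all of them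
  together.\<close>

lemma q_basis_exists:
  assumes A: "subspace A"
  obtains I where "I \<subseteq> A" "q_indep s r I" "r I = r A"
proof -
  let ?P = "\<lambda>I. I \<subseteq> A \<and> q_indep s r I"
  have "?P {0}"
    using rank_bounds[of "{0}"] subspace_0[OF A] by (auto simp: q_indep_def)
  then obtain I where I: "?P I" and Imax: "\<And>J. ?P J \<Longrightarrow> dim J \<le> dim I"
    using obtain_max_dim[of ?P] by metis
  have sI: "subspace I" and rI: "r I = int (dim I)" using I by (auto simp: q_indep_def)
  have ins: "r (span (insert x I)) \<le> r I" if "x \<in> A" for x
  proof (cases "x \<in> I")
    case True
    then show ?thesis using sI by (metis insert_absorb span_eq_iff order_refl)
  next
    case False
    let ?J = "span (insert x I)"
    have "?J \<subseteq> A" using that I A by (intro span_minimal) auto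
    moreover have d: "dim ?J = Suc (dim I)" using sI False by (rule dim_span_insert_subspace)
    \<comment> \<open>By maximality of \<open>I\<close> the larger space is dependent, so its rank
      stays below \<open>dim I + 1\<close>.\<close>
    ultimately have "r ?J \<noteq> int (dim ?J)" using Imax[of ?J] by (auto simp: q_indep_def)
    then show ?thesis using rank_bounds[of ?J] rI d by auto
  qed
  \<comment> \<open>A largest \<open>J\<close> between \<open>I\<close> and \<open>A\<close> without
    rank gain must be all of \<open>A\<close>, since any further vector of \<open>A\<close> could be
    adjoined.\<close>
  let ?Q = "\<lambda>J. subspace J \<and> I \<subseteq> J \<and> J \<subseteq> A \<and> r J \<le> r I"
  have "?Q I" using sI I by simp
  then obtain J where J: "?Q J" and Jmax: "\<And>K. ?Q K \<Longrightarrow> dim K \<le> dim J"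
    using obtain_max_dim[of ?Q] by metis
  have "A \<subseteq> J"
  proof (rule ccontr)
    assume "\<not> A \<subseteq> J"
    then obtain x where x: "x \<in> A" "x \<notin> J" by blast
    have "?Q (span (insert x J))"
    proof (intro conjI)
      show "I \<subseteq> span (insert x J)" using J span_superset[of "insert x J"] by blast
      show "span (insert x J) \<subseteq> A" using J A x(1) by (intro span_minimal) auto
      show "r (span (insert x J)) \<le> r I"
        using rank_span_insert_le[of J I x] ins[OF x(1)] J sI by linarith
    qed (rule subspace_span)
    then have "dim (span (insert x J)) \<le> dim J" by (rule Jmax)
    then show False using dim_span_insert_subspace[of J x] J x(2) by simp
  qed
  then have "r A \<le> r I" using J by auto
  moreover have "r I \<le> r A" using sI A I by (intro rank_mono) auto
  ultimately show ?thesis using that I by auto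
qed

text \<open>Between a basis of \<open>B\<close> and \<open>B\<close> itself the rank is constant, so
  the nullity is controlled by the dimension alone, which can be chosen freely.\<close>

lemma obtain_subspace_nullity:
  assumes B: "subspace B" and n: "0 \<le> n" "n \<le> nullity s r B"
  obtains C where "subspace C" "C \<subseteq> B" "r C = r B" "nullity s r C = n"
proof -
  obtain I where I: "I \<subseteq> B" "q_indep s r I" "r I = r B"
    using q_basis_exists[OF B] .
  have sI: "subspace I" and dI: "r B = int (dim I)" using I by (auto simp: q_indep_def)
  obtain C where C: "subspace C" "I \<subseteq> C" "C \<subseteq> B" "dim C = dim I + nat n"
    by (rule obtain_subspace_between[OF sI B I(1), of "dim I + nat n"])
      (use n dI in \<open>auto simp: nullity_def\<close>)
  have "r C = r B" using rank_mono[of I C] rank_mono[of C B] C sI B I by simp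
  then show ?thesis using that C dI n by (simp add: nullity_def)
qed

end

section \<open>Subspaces of the direct sum: slice, projection and section\<close>

context finite_dimensional_vector_space_prod
begin

text \<open>Rebuilds a subspace from a slice \<open>A\<close>, a projection \<open>B\<close> and a
  section \<open>g\<close>. The map \<open>g\<close> is total, but only its values on
  \<open>B\<close> enter.\<close>

definition glue :: "'b set \<Rightarrow> ('c \<Rightarrow> 'b \<times> 'c) \<Rightarrow> 'c set \<Rightarrow> ('b \<times> 'c) set"
  where "glue A g B = {u + v | u v. u \<in> iota1 ` A \<and> v \<in> g ` B}"

lemma linear_iota1: "Vector_Spaces.linear s1 scale iota1"
  by unfold_locales (auto simp: scale_def)

lemma
  assumes A: "vs1.subspace A" and B: "vs2.subspace B"
    and g: "Vector_Spaces.linear s2 scale g" "\<And>y. y \<in> B \<Longrightarrow> snd (g y) = y"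
  shows subspace_glue: "p.subspace (glue A g B)"
    and dim_glue: "p.dim (glue A g B) = vs1.dim A + vs2.dim B"
    and snd_glue: "snd ` glue A g B = B"
    and slice_glue: "fst ` (glue A g B \<inter> range iota1) = A"
proof -
  interpret i: Vector_Spaces.linear s1 scale iota1 by (rule linear_iota1)
  interpret g: Vector_Spaces.linear s2 scale g by fact
  interpret pi: finite_dimensional_vector_space_pair "(*a)" B1 scale Basis_pair
    by unfold_locales
  interpret pg: finite_dimensional_vector_space_pair "(*b)" B2 scale Basis_pair
    by unfold_locales
  have sub: "p.subspace (iota1 ` A)" "p.subspace (g ` B)"
    using A B by (auto intro: i.subspace_image g.subspace_image)
  then show "p.subspace (glue A g B)"
    unfolding glue_def by (rule p.subspace_sums)
  have inj: "inj_on g B" using g(2) by (metis inj_onI)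
  have "p.dim (iota1 ` A) = vs1.dim A"
    by (rule pi.dim_image_eq[OF linear_iota1]) (auto simp: inj_on_def)
  moreover have "p.dim (g ` B) = vs2.dim B"
    using inj by (intro pg.dim_image_eq g.linear_axioms) (simp add: vs2.span_eq_iff[THEN iffD2, OF B])
  \<comment> \<open>The sum is direct: \<open>snd\<close> vanishes on the first summand, while a
    section value \<open>g y\<close> with zero second component has \<open>y = 0\<close>.\<close>
  moreover have "iota1 ` A \<inter> g ` B \<subseteq> {0}"
  proof
    fix z assume "z \<in> iota1 ` A \<inter> g ` B"
    then obtain y where "y \<in> B" "z = g y" "snd z = 0"
      by (metis (no_types, lifting) IntE imageE snd_conv)
    then show "z \<in> {0}" using g(2)[of y] g.zero by simp
  qed
  then have "p.dim (iota1 ` A \<inter> g ` B) = 0" by simp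
  ultimately show "p.dim (glue A g B) = vs1.dim A + vs2.dim B"
    using p.dim_sums_Int[OF sub] unfolding glue_def by linarith
  show "snd ` glue A g B = B"
  proof
    show "snd ` glue A g B \<subseteq> B"
    proof
      fix y assume "y \<in> snd ` glue A g B"
      then obtain x y' where "y' \<in> B" "y = snd (iota1 x + g y')" unfolding glue_def by blast
      then show "y \<in> B" using g(2) by simp
    qed
    show "B \<subseteq> snd ` glue A g B"
    proof
      fix y assume y: "y \<in> B"
      have "iota1 0 + g y \<in> glue A g B"
        using y vs1.subspace_0[OF A] unfolding glue_def by blast
      moreover have "snd (iota1 0 + g y) = y" using g(2)[OF y] by simp
      ultimately show "y \<in> snd ` glue A g B" by (metis imageI)
    qed
  qed
  show "fst ` (glue A g B \<inter> range iota1) = A"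
  proof
    show "fst ` (glue A g B \<inter> range iota1) \<subseteq> A"
    proof
      fix x assume "x \<in> fst ` (glue A g B \<inter> range iota1)"
      then have "iota1 x \<in> glue A g B" by auto
      then obtain a y where *: "a \<in> A" "y \<in> B" "(x, 0) = (a, 0) + g y"
        unfolding glue_def by blast
      then have "y = 0" using g(2)[of y] by (metis add_0 snd_add snd_conv)
      then show "x \<in> A" using * g.zero by simp
    qed
    show "A \<subseteq> fst ` (glue A g B \<inter> range iota1)"
    proof
      fix x assume x: "x \<in> A"
      have "iota1 x + g 0 \<in> glue A g B"
        using x vs2.subspace_0[OF B] unfolding glue_def by blast
      then have "(x, 0) \<in> glue A g B \<inter> range iota1" using g.zero by simp
      then show "x \<in> fst ` (glue A g B \<inter> range iota1)" by force
    qed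
  qed
qed

lemma subspace_slice:
  assumes "p.subspace I"
  shows "vs1.subspace (fst ` (I \<inter> range iota1))"
proof -
  interpret f: Vector_Spaces.linear scale s1 fst by (rule linear_fst)
  interpret i: Vector_Spaces.linear s1 scale iota1 by (rule linear_iota1)
  show ?thesis
    using assms by (intro f.subspace_image p.subspace_inter i.subspace_image vs1.subspace_UNIV)
qed

lemma subspace_snd:
  assumes "p.subspace I"
  shows "vs2.subspace (snd ` I)"
proof -
  interpret f: Vector_Spaces.linear scale s2 snd by (rule linear_snd)
  show ?thesis using assms by (rule f.subspace_image)
qed

lemma section_exists:
  assumes "p.subspace I"
  obtains g where "Vector_Spaces.linear s2 scale g" "range g \<subseteq> I"
    "\<And>y. y \<in> snd ` I \<Longrightarrow> snd (g y) = y"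
proof -
  interpret q: vector_space_pair scale s2 by unfold_locales
  show ?thesis using q.linear_exists_right_inverse_on[OF linear_snd assms] that by auto
qed

lemma glue_subset:
  assumes "p.subspace I" "range g \<subseteq> I" "A \<subseteq> fst ` (I \<inter> range iota1)"
  shows "glue A g B \<subseteq> I"
proof
  fix z assume "z \<in> glue A g B"
  then obtain x y where z: "x \<in> A" "z = iota1 x + g y"
    unfolding glue_def by blast
  then have "iota1 x \<in> I" using assms(3) by auto
  then show "z \<in> I" unfolding z(2) using assms(1,2) by (blast intro: p.subspace_add)
qed

text \<open>Rank-nullity for \<open>snd\<close> restricted to \<open>I\<close>: its kernel is the
  embedded slice, and a section exhibits \<open>I\<close> as a \<open>glue\<close>.\<close>

lemma dim_slice_snd:
  assumes I: "p.subspace I"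
  shows "p.dim I = vs1.dim (fst ` (I \<inter> range iota1)) + vs2.dim (snd ` I)"
proof -
  obtain g where g: "Vector_Spaces.linear s2 scale g" "range g \<subseteq> I"
    "\<And>y. y \<in> snd ` I \<Longrightarrow> snd (g y) = y"
    using section_exists[OF I] by blast
  let ?K = "glue (fst ` (I \<inter> range iota1)) g (snd ` I)"
  have "I \<subseteq> ?K"
  proof
    fix z assume z: "z \<in> I"
    \<comment> \<open>Subtracting the section value removes the second component and stays in
      \<open>I\<close>, so the remainder lies in the slice.\<close>
    let ?w = "z - g (snd z)"
    have "?w \<in> I" using z g(2) I by (auto intro: p.subspace_diff)
    moreover have w: "?w = iota1 (fst ?w)" using g(3)[of "snd z"] z by (simp add: prod_eq_iff)
    ultimately have "fst ?w \<in> fst ` (I \<inter> range iota1)" by (metis IntI imageI rangeI)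
    moreover have "z = iota1 (fst ?w) + g (snd z)" using w by (metis diff_add_cancel)
    ultimately show "z \<in> ?K" using z unfolding glue_def by blast
  qed
  moreover have "?K \<subseteq> I" using I g(2) by (rule glue_subset) simp
  ultimately have "I = ?K" by (rule subset_antisym)
  then show ?thesis
    using dim_glue[OF subspace_slice[OF I] subspace_snd[OF I] g(1) g(3)] by simp
qed

end

theorem theorem3p6:
  fixes s1 :: "'k::{field,finite} \<Rightarrow> 'a::ab_group_add \<Rightarrow> 'a"
    and s2 :: "'k \<Rightarrow> 'b::ab_group_add \<Rightarrow> 'b"
    and r1 :: "'a set \<Rightarrow> int" and r2 :: "'b set \<Rightarrow> int"
    and X :: "('a \<times> 'b) set"
  assumes "q_matroid s1 Basis1 r1" and "q_matroid s2 Basis2 r2"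
    and "module.subspace (module_prod.scale s1 s2) X"
  shows "rank_of_indep (module_prod.scale s1 s2) (free_product_indep s1 r1 s2 r2) X =
    r1 (fst ` (X \<inter> range iota1)) + r2 (snd ` X) +
    min (rank_lack r1 (fst ` (X \<inter> range iota1))) (nullity s2 r2 (snd ` X))"
proof -
  interpret M1: q_matroid s1 Basis1 r1 by fact
  interpret M2: q_matroid s2 Basis2 r2 by fact
  interpret finite_dimensional_vector_space_prod s1 s2 Basis1 Basis2 by unfold_locales
  let ?slice = "\<lambda>I. fst ` (I \<inter> range iota1) :: 'a set"
  let ?I = "free_product_indep s1 r1 s2 r2"
  let ?A = "?slice X" and ?B = "snd ` X"
  define m where "m = min (rank_lack r1 ?A) (nullity s2 r2 ?B)"
  note X = assms(3)
  note A = subspace_slice[OF X] and B = subspace_snd[OF X]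

  have upper: "int (p.dim (X \<inter> I)) \<le> r1 ?A + r2 ?B + m" if "I \<in> ?I" for I
  proof -
    have I: "p.subspace I" "q_indep s1 r1 (?slice I)"
      "nullity s2 r2 (snd ` I) \<le> rank_lack r1 (?slice I)"
      using that by (auto simp: free_product_indep_def)
    have XI: "p.subspace (X \<inter> I)" using X I(1) by (rule p.subspace_inter)
    let ?A' = "?slice (X \<inter> I)" and ?B' = "snd ` (X \<inter> I)"
    note A' = subspace_slice[OF XI] and B' = subspace_snd[OF XI]
    have AI: "M1.subspace (?slice I)" and BI: "M2.subspace (snd ` I)"
      using I(1) by (simp_all add: subspace_slice subspace_snd)
    have "q_indep s1 r1 ?A'"
      by (rule M1.q_indep_subset[OF I(2) A']) auto
    then have dA: "int (M1.dim ?A') = r1 ?A'" by (simp add: q_indep_def)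
    have "r1 ?A' \<le> r1 ?A" by (rule M1.rank_mono[OF A' A]) auto
    moreover have "r2 ?B' \<le> r2 ?B" by (rule M2.rank_mono[OF B' B]) auto
    moreover have "nullity s2 r2 ?B' \<le> nullity s2 r2 ?B" by (rule M2.nullity_mono[OF B' B]) auto
    moreover have "nullity s2 r2 ?B' \<le> nullity s2 r2 (snd ` I)"
      by (rule M2.nullity_mono[OF B' BI]) auto
    moreover have "r1 ?A' \<le> r1 (?slice I)" by (rule M1.rank_mono[OF A' AI]) auto
    \<comment> \<open>The dimension is \<open>r1 ?A' + r2 ?B' + nullity s2 r2 ?B'\<close>. Bounding
      the nullity by that of \<open>?B\<close> gives one arm of the minimum. For the other, it is at
      most \<open>r1 UNIV - r1 (?slice I)\<close>, hence at most \<open>r1 UNIV - r1 ?A'\<close>,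
      and \<open>r1 ?A'\<close> cancels.\<close>
    ultimately show ?thesis
      using dim_slice_snd[OF XI] dA I(3) by (auto simp: m_def nullity_def rank_lack_def)
  qed

  obtain K where K: "K \<in> ?I" "K \<subseteq> X" "int (p.dim K) = r1 ?A + r2 ?B + m"
  proof -
    have m0: "0 \<le> m" "m \<le> nullity s2 r2 ?B"
      using M1.rank_lack_nonneg[OF A] M2.nullity_nonneg[OF B] by (auto simp: m_def)
    obtain A' where A': "A' \<subseteq> ?A" "q_indep s1 r1 A'" "r1 A' = r1 ?A"
      using M1.q_basis_exists[OF A] .
    obtain B' where B': "M2.subspace B'" "B' \<subseteq> ?B" "r2 B' = r2 ?B" "nullity s2 r2 B' = m"
      using M2.obtain_subspace_nullity[OF B m0] .
    obtain g where g: "Vector_Spaces.linear s2 scale g" "range g \<subseteq> X"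
      "\<And>y. y \<in> ?B \<Longrightarrow> snd (g y) = y"
      using section_exists[OF X] by blast
    have sA': "M1.subspace A'" using A'(2) by (simp add: q_indep_def)
    have g': "snd (g y) = y" if "y \<in> B'" for y using that B'(2) g(3) by blast
    note glue = subspace_glue[OF sA' B'(1) g(1) g'] dim_glue[OF sA' B'(1) g(1) g']
      snd_glue[OF sA' B'(1) g(1) g'] slice_glue[OF sA' B'(1) g(1) g']
    show ?thesis
    proof (rule that)
      \<comment> \<open>\<open>A'\<close> has the same rank lack as \<open>?A\<close>, and the
        nullity \<open>m\<close> of \<open>B'\<close> was chosen not to exceed it.\<close>
      show "glue A' g B' \<in> ?I"
        using glue A' B' by (simp add: free_product_indep_def rank_lack_def m_def)
      show "glue A' g B' \<subseteq> X" using X g(2) A'(1) by (rule glue_subset)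
      show "int (p.dim (glue A' g B')) = r1 ?A + r2 ?B + m"
        using glue(2) A' B' by (simp add: q_indep_def nullity_def)
    qed
  qed

  have "Max {p.dim (X \<inter> I) | I. I \<in> ?I} = p.dim K"
  proof (rule Max_eqI)
    show "finite {p.dim (X \<inter> I) | I. I \<in> ?I}"
      by (rule finite_subset[of _ "{..p.dim X}"]) (auto intro: p.dim_subset)
    show "n \<le> p.dim K" if "n \<in> {p.dim (X \<inter> I) | I. I \<in> ?I}" for n
      using that upper K(3) by fastforce
    \<comment> \<open>Since \<open>K\<close> lies inside \<open>X\<close>, its full dimension is
      among the values maximized.\<close>
    have "X \<inter> K = K" using K(2) by blast
    then show "p.dim K \<in> {p.dim (X \<inter> I) | I. I \<in> ?I}" using K(1) by (metis (mono_tags, lifting) mem_Collect_eq)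
  qed
  then show ?thesis using K(3) by (simp add: rank_of_indep_def m_def)
qed

end
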